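(* Let $n$ and $k$ be positive integers. Let $\mathfrak{C}$ be a finite cyclic group that acts freely on $[0,n-1]=\{0,\ldots,n-1\}$. Then $\mathfrak{C}$ acts on the book graph $B_n$, and $$\left(\mathcal{I}_k(B_n),\ \mathfrak{C},\ 2\begin{bmatrix} n\\ k-1\end{bmatrix}+\sum_{j=0}^k \begin{bmatrix} n\\ j\end{bmatrix}\begin{bmatrix} n-j\\ k-j\end{bmatrix}\right)$$ exhibits the cyclic sieving phenomenon.
   Context: The book graph $B_n$ has vertex set $\{0,\ldots,n\}\times\{+1,-1\}$, with edges $(i,j)\sim(n,j)$ and $(i,j)\sim(i,-j)$ for $i\in\{0,\ldots,n-1\}$ and $j\in\{-1,1\}$, and also the edge $(n,1)\sim(n,-1)$. The action of $\mathfrak{C}$ on $B_n$: the vertices $(n,1)$ and $(n,-1)$ are fixed, and $\mathfrak{g}\cdot(i,j)=(\mathfrak{g}\cdot i,j)$ for $i\in\{0,\ldots,n-1\}$, $j\in\{-1,1\}$. An action on a set is free if only the identity element fixes any point. $\mathcal{I}_k(G)$ is the collection of independent sets of size $k$ of a graph $G$; a group acting on $G$ by automorphisms acts on $\mathcal{I}_k(G)$ by $\mathfrak{g}S=\{\mathfrak{g}v:v\in S\}$. $[m]=1+q+\cdots+q^{m-1}$, and $\begin{bmatrix} a\\ b\end{bmatrix}$ is the $q$-binomial coefficient, equal to $\frac{[a]!}{[b]!\,[a-b]!}$ for $0\le b\le a$ (with $[m]!=[1][2]\cdots[m]$) and $0$ otherwise. Cyclic sieving phenomenon (CSP): for a finite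 cyclic group $\mathfrak{C}$, a finite set $X$ and a polynomial $f(q)$, the triple $(X,\mathfrak{C},f(q))$ exhibits the CSP if $\mathfrak{C}$ acts on $X$ and for every $\mathfrak{g}\in\mathfrak{C}$ of order $d$ and every primitive $d$th root of unity $\omega\in\mathbb{C}$ we have $|X^{\mathfrak{g}}|=f(\omega)$, where $X^{\mathfrak{g}}=\{x\in X:\mathfrak{g}x=x\}$. *)

theory Defs
  imports
    Complex_Main
    "HOL-Computational_Algebra.Polynomial"
    "HOL-Algebra.Elementary_Groups"
    "HOL-Algebra.Multiplicative_Group"
    "HOL-Algebra.Group_Action"
    "Graph_Theory.Pair_Digraph"
begin

section \<open>q-analogues\<close>

definition q_int :: "nat \<Rightarrow> complex poly" where
  "q_int m = (\<Sum>i<m. Polynomial.monom 1 i)"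

definition q_fact :: "nat \<Rightarrow> complex poly" where
  "q_fact m = (\<Prod>i=1..m. q_int i)"

text \<open>The division is exact, see \<open>q_binom_mult_q_fact\<close> below.\<close>

definition q_binom :: "nat \<Rightarrow> nat \<Rightarrow> complex poly" where
  "q_binom a b = (if b \<le> a then q_fact a div (q_fact b * q_fact (a - b)) else 0)"

lemma q_int_add: "q_int (a + b) = q_int a + Polynomial.monom 1 a * q_int b"
  by (induction b) (simp_all add: q_int_def algebra_simps mult_monom)

lemma q_fact_0 [simp]: "q_fact 0 = 1"
  by (simp add: q_fact_def)

lemma q_fact_Suc: "q_fact (Suc m) = q_int (Suc m) * q_fact m"
  by (simp add: q_fact_def mult.commute)

lemma q_int_nonzero: "m > 0 \<Longrightarrow> q_int m \<noteq> 0"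
proof
  assume "m > 0" "q_int m = 0"
  then have "poly (q_int m) 1 = 0" by simp
  moreover have "poly (q_int m) 1 = of_nat m"
    by (simp add: q_int_def poly_sum poly_monom)
  ultimately show False using \<open>m > 0\<close> by simp
qed

lemma q_fact_nonzero: "q_fact m \<noteq> 0"
  by (auto simp: q_fact_def q_int_nonzero)

lemma q_fact_mult_dvd: "q_fact b * q_fact c dvd q_fact (b + c)"
proof (induction "b + c" arbitrary: b c)
  case 0
  then show ?case by simp
next
  case (Suc s)
  show ?case
  proof (cases "b = 0 \<or> c = 0")
    case True
    then show ?thesis by auto
  next
    case False
    then obtain b' c' where b: "b = Suc b'" and c: "c = Suc c'"
      by (metis not0_implies_Suc)
    have s: "s = b' + c" "s = b + c'" using Suc.hyps(2) b c by auto
    have 1: "q_fact b' * q_fact c dvd q_fact s"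
      using Suc.hyps(1)[OF s(1)] s(1) by simp
    have 2: "q_fact b * q_fact c' dvd q_fact s"
      using Suc.hyps(1)[OF s(2)] s(2) by simp
    have "q_fact (b + c) = q_int (b + c) * q_fact s"
      using Suc.hyps(2) q_fact_Suc[of s] by simp
    also have "\<dots> = q_int b * q_fact s + Polynomial.monom 1 b * (q_int c * q_fact s)"
      by (simp add: q_int_add algebra_simps)
    finally have eq: "q_fact (b + c) = \<dots>" .
    have "q_fact b * q_fact c = q_int b * (q_fact b' * q_fact c)"
      by (simp add: b q_fact_Suc)
    then have "q_fact b * q_fact c dvd q_int b * q_fact s"
      using 1 by (metis dvd_refl mult_dvd_mono)
    moreover have "q_fact b * q_fact c = q_int c * (q_fact b * q_fact c')"
      by (simp add: c q_fact_Suc)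
    then have "q_fact b * q_fact c dvd q_int c * q_fact s"
      using 2 by (metis dvd_refl mult_dvd_mono)
    ultimately show ?thesis
      unfolding eq by (intro dvd_add) (auto intro: dvd_mult)
  qed
qed

lemma q_binom_mult_q_fact:
  assumes "b \<le> a"
  shows "q_binom a b * (q_fact b * q_fact (a - b)) = q_fact a"
  using q_fact_mult_dvd[of b "a - b"] assms by (simp add: q_binom_def)

section \<open>Cyclic sieving\<close>

definition primitive_root_of_unity :: "nat \<Rightarrow> complex \<Rightarrow> bool" where
  "primitive_root_of_unity d \<omega> \<longleftrightarrow>
     d > 0 \<and> \<omega> ^ d = 1 \<and> (\<forall>m. 0 < m \<and> m < d \<longrightarrow> \<omega> ^ m \<noteq> 1)"

definition free_action :: "('g, 'm) monoid_scheme \<Rightarrow> 'x set \<Rightarrow> ('g \<Rightarrow> 'x \<Rightarrow> 'x) \<Rightarrow> bool" where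
  "free_action C X \<phi> \<longleftrightarrow>
     group_action C X \<phi> \<and> (\<forall>g\<in>carrier C. (\<exists>x\<in>X. \<phi> g x = x) \<longrightarrow> g = \<one>\<^bsub>C\<^esub>)"

definition cyclic_sieving ::
  "'x set \<Rightarrow> ('g, 'm) monoid_scheme \<Rightarrow> ('g \<Rightarrow> 'x \<Rightarrow> 'x) \<Rightarrow> complex poly \<Rightarrow> bool" where
  "cyclic_sieving X C \<phi> f \<longleftrightarrow>
     cyclic_group C \<and> finite (carrier C) \<and> finite X \<and> group_action C X \<phi> \<and>
     (\<forall>g\<in>carrier C. \<forall>\<omega>. primitive_root_of_unity (group.ord C g) \<omega> \<longrightarrow>
        of_nat (card (invariants X \<phi> g)) = poly f \<omega>)"

section \<open>Graphs, independent sets and actions by automorphisms\<close>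

text \<open>A simple graph is represented as a \<^locale>\<open>pair_graph\<close>, that is, by its
  symmetric and irreflexive adjacency relation \<^const>\<open>parcs\<close>.\<close>

definition independent_sets :: "nat \<Rightarrow> 'v pair_pre_digraph \<Rightarrow> 'v set set" where
  "independent_sets k \<Gamma> =
     {S. S \<subseteq> pverts \<Gamma> \<and> finite S \<and> card S = k \<and> (\<forall>u\<in>S. \<forall>v\<in>S. (u, v) \<notin> parcs \<Gamma>)}"

definition graph_action ::
  "('g, 'm) monoid_scheme \<Rightarrow> 'v pair_pre_digraph \<Rightarrow> ('g \<Rightarrow> 'v \<Rightarrow> 'v) \<Rightarrow> bool" where
  "graph_action C \<Gamma> \<psi> \<longleftrightarrow>
     group_action C (pverts \<Gamma>) \<psi> \<and>
     (\<forall>g\<in>carrier C. \<forall>u\<in>pverts \<Gamma>. \<forall>v\<in>pverts \<Gamma>.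
        (\<psi> g u, \<psi> g v) \<in> parcs \<Gamma> \<longleftrightarrow> (u, v) \<in> parcs \<Gamma>)"

text \<open>The restriction to the set acted upon is needed because \<^const>\<open>BijGroup\<close>
  consists of extensional functions.\<close>

definition independent_sets_action ::
  "nat \<Rightarrow> 'v pair_pre_digraph \<Rightarrow> ('g \<Rightarrow> 'v \<Rightarrow> 'v) \<Rightarrow> 'g \<Rightarrow> 'v set \<Rightarrow> 'v set" where
  "independent_sets_action k \<Gamma> \<psi> g = (\<lambda>S\<in>independent_sets k \<Gamma>. \<psi> g ` S)"

section \<open>Book graphs\<close>

definition book_edges :: "nat \<Rightarrow> ((nat \<times> int) \<times> (nat \<times> int)) set" where
  "book_edges n =
     {((i, j), (n, j)) | i j. i < n \<and> j \<in> {-1, 1}} \<union>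
     {((i, j), (i, - j)) | i j. i < n \<and> j \<in> {-1, 1}} \<union>
     {((n, 1), (n, -1))}"

definition book_graph :: "nat \<Rightarrow> (nat \<times> int) pair_pre_digraph" where
  "book_graph n =
     \<lparr>pverts = {0..n} \<times> {1, -1}, parcs = book_edges n \<union> (book_edges n)\<inverse>\<rparr>"

lemma pair_graph_book_graph: "pair_graph (book_graph n)"
proof
  have sub: "book_edges n \<subseteq> ({0..n} \<times> {1, -1}) \<times> ({0..n} \<times> {1, -1})"
    by (auto simp: book_edges_def)
  then show "finite (parcs (book_graph n))"
    by (auto simp: book_graph_def intro: finite_subset)
  show "finite (pverts (book_graph n))"
    by (simp add: book_graph_def)
  show "fst e \<in> pverts (book_graph n)" if "e \<in> parcs (book_graph n)" for e
    using that sub by (auto simp: book_graph_def)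
  show "snd e \<in> pverts (book_graph n)" if "e \<in> parcs (book_graph n)" for e
    using that sub by (auto simp: book_graph_def)
  show "fst e \<noteq> snd e" if "e \<in> parcs (book_graph n)" for e
    using that by (auto simp: book_graph_def book_edges_def)
  show "symmetric (with_proj (book_graph n))"
    by (auto simp: symmetric_def book_graph_def sym_def)
qed

definition book_action :: "nat \<Rightarrow> ('g \<Rightarrow> nat \<Rightarrow> nat) \<Rightarrow> 'g \<Rightarrow> nat \<times> int \<Rightarrow> nat \<times> int" where
  "book_action n \<phi> g =
     restrict (\<lambda>(i, j). if i = n then (i, j) else (\<phi> g i, j)) (pverts (book_graph n))"

end

theory Submission
  imports Defs
begin

text \<open>
  Fix \<open>g\<close> of order \<open>d\<close> and a primitive \<open>d\<close>-th root of unity \<open>\<omega>\<close>. Since the action on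
  \<open>{0..<n}\<close> is free, all cycles of \<open>g\<close> there have length exactly \<open>d\<close>
  (\<open>free_action_semiregular_on\<close>).

  The first ingredient is that for any finite set \<open>X\<close> that \<open>g\<close> permutes in cycles of length
  \<open>d\<close>, the number of \<open>g\<close>-invariant \<open>m\<close>-subsets is the q-binomial coefficient of \<open>card X\<close> and
  \<open>m\<close> at \<open>\<omega>\<close> (\<open>card_invariant_subsets\<close>). Both numbers satisfy
  \<open>c (a + d) m = c a m + c a (m - d)\<close>, the last term being present only for \<open>d \<le> m\<close>. For
  invariant sets this distinguishes whether a chosen orbit is contained in the set or disjoint from
  it. For q-binomial coefficients it is the q-Vandermonde identity, in which the intermediate terms
  vanish because \<open>\<omega>\<close> is a root of \<open>[d]\<close> (\<open>q_binom_add_order\<close>).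

  The second ingredient is the shape of the independent sets. Those through \<open>(n, 1)\<close> correspond
  to \<open>(k - 1)\<close>-subsets of \<open>{0..<n}\<close>, and so do those through \<open>(n, -1)\<close>; those avoiding both
  correspond to pairs of disjoint subsets with \<open>k\<close> elements in total. These correspondences commute
  with the action (\<open>fixed_independent_sets_book_graph\<close>). The first two families account for the
  summand \<open>2 * q_binom n (k - 1)\<close>. For the pairs \<open>(A, B)\<close>, the complement of an invariant \<open>A\<close>
  of size \<open>j\<close> is again permuted in cycles of length \<open>d\<close>, and the first ingredient, applied to
  \<open>A\<close> and then to \<open>B\<close> in that complement, gives
  \<open>q_binom n j * q_binom (n - j) (k - j)\<close> (\<open>card_invariant_disjoint_pairs\<close>).
\<close>

section \<open>q-binomial coefficients\<close>

lemma q_binom_0_right [simp]: "q_binom a 0 = 1"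
  by (simp add: q_binom_def q_fact_nonzero)

lemma q_binom_self [simp]: "q_binom a a = 1"
  by (simp add: q_binom_def q_fact_nonzero)

lemma q_binom_eq_0: "a < b \<Longrightarrow> q_binom a b = 0"
  by (simp add: q_binom_def)

text \<open>For \<open>b < a\<close>, after multiplication by \<open>[b+1]! [a-b]!\<close>, the identity becomes
  \<open>[b+1] + q\<^sup>b\<^sup>+\<^sup>1 [a-b] = [a+1]\<close>, and the multiplier is a nonzero polynomial.\<close>

lemma q_binom_Suc_Suc:
  "q_binom (Suc a) (Suc b) = q_binom a b + Polynomial.monom 1 (Suc b) * q_binom a (Suc b)"
proof -
  consider "b < a" | "b = a" | "a < b" by linarith
  then show ?thesis
  proof cases
    case 1
    then obtain c where a: "a = Suc (b + c)"
      using less_imp_Suc_add by blast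
    let ?F = "q_fact (Suc b) * q_fact (Suc c)"
    have 1: "q_binom a b * (q_fact b * q_fact (Suc c)) = q_fact a"
      using q_binom_mult_q_fact[of b a] by (simp add: a)
    have 2: "q_binom a (Suc b) * (q_fact (Suc b) * q_fact c) = q_fact a"
      using q_binom_mult_q_fact[of "Suc b" a] by (simp add: a)
    have "(q_binom a b + Polynomial.monom 1 (Suc b) * q_binom a (Suc b)) * ?F =
        q_int (Suc b) * (q_binom a b * (q_fact b * q_fact (Suc c))) +
        Polynomial.monom 1 (Suc b) * q_int (Suc c) * (q_binom a (Suc b) * (q_fact (Suc b) * q_fact c))"
      by (simp add: q_fact_Suc algebra_simps)
    also have "\<dots> = q_int (Suc b + Suc c) * q_fact a"
      unfolding 1 2 q_int_add by (simp add: algebra_simps)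
    also have "\<dots> = q_fact (Suc a)"
      by (simp add: q_fact_Suc a)
    also have "\<dots> = q_binom (Suc a) (Suc b) * ?F"
      using q_binom_mult_q_fact[of "Suc b" "Suc a"] by (simp add: a)
    finally show ?thesis
      by (simp add: q_fact_nonzero)
  qed (simp_all add: q_binom_eq_0)
qed

text \<open>Induction on \<open>b\<close>, applying Pascal's rule to the left-hand side and to every \<open>q_binom (Suc b) j\<close>
  on the right. The truncated subtraction in \<open>b - j\<close> is harmless, since \<open>q_binom b j\<close> vanishes
  for \<open>j > b\<close>.\<close>

lemma q_Vandermonde:
  fixes q :: complex
  shows "poly (q_binom (a + b) m) q =
    (\<Sum>j\<le>m. poly (q_binom a (m - j)) q * poly (q_binom b j) q * q ^ ((m - j) * (b - j)))"
proof (induction b arbitrary: m)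
  case 0
  have "(\<Sum>j\<le>m. poly (q_binom a (m - j)) q * poly (q_binom 0 j) q * q ^ ((m - j) * (0 - j))) =
      (\<Sum>j\<in>{0}. poly (q_binom a (m - j)) q * poly (q_binom 0 j) q * q ^ ((m - j) * (0 - j)))"
    by (rule sum.mono_neutral_right) (auto simp: q_binom_eq_0)
  then show ?case by simp
next
  case (Suc b)
  show ?case
  proof (cases m)
    case 0
    then show ?thesis by simp
  next
    case (Suc l)
    let ?A = "\<lambda>i. poly (q_binom a i) q" and ?B = "\<lambda>j. poly (q_binom b j) q"
    let ?T = "\<lambda>j. ?A (m - j) * poly (q_binom (Suc b) j) q * q ^ ((m - j) * (Suc b - j))"
    \<comment> \<open>the terms of the inductive hypothesis at \<open>m\<close>, multiplied by \<open>q ^ m\<close>, are those of the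
      part \<open>q ^ j * q_binom b j\<close> of \<open>q_binom (Suc b) j\<close>\<close>
    have keep: "q ^ Suc l * (?A (m - j) * ?B j * q ^ ((m - j) * (b - j)))
        = ?A (m - j) * (q ^ j * ?B j) * q ^ ((m - j) * (Suc b - j))" if "j \<le> m" for j
    proof (cases "j \<le> b")
      case True
      have "Suc l + (m - j) * (b - j) = j + (m - j) * (Suc b - j)"
        using True that Suc by (simp add: Suc_diff_le)
      then have "q ^ Suc l * q ^ ((m - j) * (b - j)) = q ^ j * q ^ ((m - j) * (Suc b - j))"
        by (metis power_add)
      then show ?thesis by (simp add: ac_simps)
    next
      case False
      then show ?thesis by (simp add: q_binom_eq_0)
    qed
    have pascal: "?T (Suc j) = ?A (l - j) * ?B j * q ^ ((l - j) * (b - j)) +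
        ?A (m - Suc j) * (q ^ Suc j * ?B (Suc j)) * q ^ ((m - Suc j) * (Suc b - Suc j))" for j
      by (simp add: q_binom_Suc_Suc poly_monom Suc algebra_simps)
    have "poly (q_binom (a + Suc b) m) q =
        poly (q_binom (a + b) l) q + q ^ Suc l * poly (q_binom (a + b) m) q"
      by (simp add: Suc q_binom_Suc_Suc poly_monom)
    also have "q ^ Suc l * poly (q_binom (a + b) m) q =
        (\<Sum>j\<le>m. ?A (m - j) * (q ^ j * ?B j) * q ^ ((m - j) * (Suc b - j)))"
      unfolding Suc.IH sum_distrib_left by (rule sum.cong) (simp_all only: keep atMost_iff)
    also have "\<dots> = ?A m * q ^ (m * Suc b) +
        (\<Sum>j\<le>l. ?A (m - Suc j) * (q ^ Suc j * ?B (Suc j)) * q ^ ((m - Suc j) * (Suc b - Suc j)))"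
      unfolding Suc by (subst sum.atMost_Suc_shift) simp
    also have "poly (q_binom (a + b) l) q =
        (\<Sum>j\<le>l. ?A (l - j) * ?B j * q ^ ((l - j) * (b - j)))"
      by (rule Suc.IH)
    finally have "poly (q_binom (a + Suc b) m) q = ?A m * q ^ (m * Suc b) + (\<Sum>j\<le>l. ?T (Suc j))"
      unfolding pascal sum.distrib by (simp only: ac_simps)
    also have "\<dots> = (\<Sum>j\<le>m. ?T j)"
      unfolding Suc by (subst sum.atMost_Suc_shift) simp
    finally show ?thesis .
  qed
qed

section \<open>Roots of unity\<close>

lemma q_int_root_of_unity:
  assumes "primitive_root_of_unity d \<omega>" "0 < i" "i < d"
  shows "poly (q_int i) \<omega> \<noteq> 0"
proof
  assume "poly (q_int i) \<omega> = 0"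
  then have "(\<Sum>j<i. \<omega> ^ j) = 0"
    by (simp add: q_int_def poly_sum poly_monom)
  then have "\<omega> ^ i = 1"
    using power_diff_1_eq[of \<omega> i] by simp
  then show False
    using assms by (auto simp: primitive_root_of_unity_def)
qed

text \<open>The numerator \<open>[d]!\<close> vanishes at \<open>\<omega>\<close> because of its factor \<open>[d]\<close>, while no factor of the
  denominator \<open>[j]! [d-j]!\<close> does.\<close>

lemma q_binom_root_of_unity_eq_0:
  assumes "primitive_root_of_unity d \<omega>" "0 < j" "j < d"
  shows "poly (q_binom d j) \<omega> = 0"
proof -
  have nonzero: "poly (q_fact i) \<omega> \<noteq> 0" if "i < d" for i
    using that q_int_root_of_unity[OF assms(1)] by (auto simp: q_fact_def poly_prod)
  have "\<omega> \<noteq> 1" "\<omega> ^ d = 1"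
    using assms unfolding primitive_root_of_unity_def by (auto dest: spec[of _ 1])
  then have "(\<Sum>i<d. \<omega> ^ i) = 0"
    using power_diff_1_eq[of \<omega> d] by simp
  then have "poly (q_int d) \<omega> = 0"
    by (simp add: q_int_def poly_sum poly_monom)
  then have "poly (q_fact d) \<omega> = 0"
    using assms by (auto simp: q_fact_def poly_prod)
  moreover have "poly (q_binom d j) \<omega> * (poly (q_fact j) \<omega> * poly (q_fact (d - j)) \<omega>) =
      poly (q_fact d) \<omega>"
    using q_binom_mult_q_fact[of j d] assms by (metis less_imp_le poly_mult)
  ultimately show ?thesis
    using nonzero[of j] nonzero[of "d - j"] assms by simp
qed

text \<open>This is the recursion that drives the count of invariant sets. In the q-Vandermonde identity with
  \<open>b = d\<close> only the terms \<open>j = 0\<close> and \<open>j = d\<close> survive at a primitive \<open>d\<close>-th root of unity, and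
  their powers of \<open>\<omega>\<close> have exponents divisible by \<open>d\<close>.\<close>

lemma q_binom_add_order:
  assumes \<omega>: "primitive_root_of_unity d \<omega>"
  shows "poly (q_binom (a + d) m) \<omega> =
    poly (q_binom a m) \<omega> + (if d \<le> m then poly (q_binom a (m - d)) \<omega> else 0)"
proof -
  let ?T = "\<lambda>j. poly (q_binom a (m - j)) \<omega> * poly (q_binom d j) \<omega> * \<omega> ^ ((m - j) * (d - j))"
  have d: "d > 0" "\<omega> ^ d = 1"
    using \<omega> by (auto simp: primitive_root_of_unity_def)
  have vanish: "poly (q_binom d j) \<omega> = 0" if "j \<noteq> 0" "j \<noteq> d" for j
    using that q_binom_root_of_unity_eq_0[OF \<omega>, of j] by (cases "j < d") (auto simp: q_binom_eq_0)
  have "poly (q_binom (a + d) m) \<omega> = (\<Sum>j\<le>m. ?T j)"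
    by (rule q_Vandermonde)
  also have "\<dots> = (\<Sum>j\<in>{0, d} \<inter> {..m}. ?T j)"
    by (rule sum.mono_neutral_right) (auto simp: vanish)
  also have "\<dots> = ?T 0 + (if d \<le> m then ?T d else 0)"
    using d(1) by auto
  also have "?T 0 = poly (q_binom a m) \<omega>"
    using d by (simp add: power_mult mult.commute[of m])
  finally show ?thesis by simp
qed

section \<open>Invariant subsets\<close>

text \<open>All cycles of \<open>f\<close> on \<open>X\<close> have length exactly \<open>d\<close>: for \<open>d > 0\<close>, iterating \<open>f\<close> is a free
  action of the cyclic group of order \<open>d\<close>. Bijectivity is a consequence, so that the property
  passes to any subset mapped into itself.\<close>

definition semiregular_on :: "nat \<Rightarrow> ('a \<Rightarrow> 'a) \<Rightarrow> 'a set \<Rightarrow> bool" where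
  "semiregular_on d f X \<longleftrightarrow> f ` X \<subseteq> X \<and> (\<forall>x\<in>X. (f ^^ d) x = x) \<and>
     (\<forall>x\<in>X. \<forall>i. 0 < i \<and> i < d \<longrightarrow> (f ^^ i) x \<noteq> x)"

lemma semiregular_on_subset:
  "semiregular_on d f X \<Longrightarrow> Y \<subseteq> X \<Longrightarrow> f ` Y \<subseteq> Y \<Longrightarrow> semiregular_on d f Y"
  unfolding semiregular_on_def by blast

lemma funpow_closed: "f ` Y \<subseteq> Y \<Longrightarrow> x \<in> Y \<Longrightarrow> (f ^^ i) x \<in> Y"
  by (induction i) auto

lemma semiregular_on_inj:
  assumes "semiregular_on d f X" "d > 0"
  shows "inj_on f X"
proof (rule inj_on_inverseI)
  fix x assume "x \<in> X"
  then show "(f ^^ (d - 1)) (f x) = x"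
    using assms by (metis Suc_diff_1 comp_apply funpow_Suc_right semiregular_on_def)
qed

lemma semiregular_on_Diff:
  assumes "semiregular_on d f X" "d > 0" "finite X" "Y \<subseteq> X" "f ` Y \<subseteq> Y"
  shows "semiregular_on d f (X - Y)"
proof (rule semiregular_on_subset[OF assms(1)])
  have inj: "inj_on f X" using semiregular_on_inj assms by blast
  have "f ` Y = Y"
    using assms inj by (meson endo_inj_surj finite_subset inj_on_subset)
  then show "f ` (X - Y) \<subseteq> X - Y"
    using inj assms(1,4) unfolding semiregular_on_def by (auto simp: inj_on_def)
qed blast

text \<open>The orbit of \<open>x\<close> has \<open>d\<close> elements and is a minimal nonempty invariant set: an invariant \<open>S\<close> that
  contains some \<open>f\<^sup>i x\<close> also contains \<open>f\<^sup>d\<^sup>-\<^sup>i (f\<^sup>i x) = x\<close>, hence the whole orbit.\<close>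

lemma semiregular_on_orbit:
  assumes f: "semiregular_on d f X" and "d > 0" and "x \<in> X"
  defines "Or \<equiv> (\<lambda>i. (f ^^ i) x) ` {..<d}"
  shows "x \<in> Or" "Or \<subseteq> X" "f ` Or \<subseteq> Or" "card Or = d"
    and "\<And>S. S \<subseteq> X \<Longrightarrow> f ` S \<subseteq> S \<Longrightarrow> S \<inter> Or \<noteq> {} \<Longrightarrow> Or \<subseteq> S"
proof -
  have X: "f ` X \<subseteq> X" and per: "(f ^^ d) x = x"
    using f \<open>x \<in> X\<close> by (auto simp: semiregular_on_def)
  show "x \<in> Or"
    unfolding Or_def using \<open>d > 0\<close> by (metis funpow_0 imageI lessThan_iff)
  show "Or \<subseteq> X"
    using funpow_closed[OF X \<open>x \<in> X\<close>] by (auto simp: Or_def)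
  show "f ` Or \<subseteq> Or"
  proof clarify
    fix y assume "y \<in> Or"
    then obtain i where i: "i < d" "y = (f ^^ i) x"
      by (auto simp: Or_def)
    show "f y \<in> Or"
    proof (cases "Suc i < d")
      case True
      then show ?thesis
        unfolding Or_def i(2) by (intro image_eqI[of _ _ "Suc i"]) simp_all
    next
      case False
      then have "d = Suc i" using i by simp
      then have "f y = x" using per i by simp
      then show ?thesis using \<open>x \<in> Or\<close> by simp
    qed
  qed
  have neq: "(f ^^ i) x \<noteq> (f ^^ j) x" if "i < j" "j < d" for i j
  proof
    assume eq: "(f ^^ i) x = (f ^^ j) x"
    have "(f ^^ (j - i)) ((f ^^ i) x) = (f ^^ j) x"
      using that funpow_add[of "j - i" i f] by simp
    then have "(f ^^ (j - i)) ((f ^^ i) x) = (f ^^ i) x"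
      using eq by simp
    moreover have "(f ^^ i) x \<in> X"
      using funpow_closed[OF X \<open>x \<in> X\<close>] .
    ultimately show False
      using f that by (simp add: semiregular_on_def)
  qed
  have "inj_on (\<lambda>i. (f ^^ i) x) {..<d}"
    by (rule inj_onI) (metis neq lessThan_iff linorder_neqE_nat)
  then show "card Or = d"
    by (simp add: Or_def card_image)
  fix S assume S: "S \<subseteq> X" "f ` S \<subseteq> S" "S \<inter> Or \<noteq> {}"
  then obtain i where i: "i < d" "(f ^^ i) x \<in> S"
    by (auto simp: Or_def)
  have "(f ^^ (d - i)) ((f ^^ i) x) = x"
    using i per funpow_add[of "d - i" i f] by simp
  then have "x \<in> S"
    using funpow_closed[OF S(2) i(2)] by metis
  then show "Or \<subseteq> S"
    using funpow_closed[OF S(2)] by (auto simp: Or_def)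
qed

text \<open>Requiring only \<open>f ` S \<subseteq> S\<close> is enough, since on finite sets an injective \<open>f\<close> then satisfies
  \<open>f ` S = S\<close>.\<close>

definition invariant_subsets :: "('a \<Rightarrow> 'a) \<Rightarrow> 'a set \<Rightarrow> nat \<Rightarrow> 'a set set" where
  "invariant_subsets f X m = {S. S \<subseteq> X \<and> card S = m \<and> f ` S \<subseteq> S}"

lemma finite_invariant_subsets [simp]: "finite X \<Longrightarrow> finite (invariant_subsets f X m)"
  by (rule finite_subset[of _ "Pow X"]) (auto simp: invariant_subsets_def)

text \<open>Induction on \<open>card X\<close>. Fix one orbit. An invariant set of size \<open>m\<close> either avoids it, and is then
  an invariant subset of the rest, or contains it, and is then the orbit together with an
  invariant subset of the rest of size \<open>m - d\<close>. The values of the q-binomial coefficients at \<open>\<omega>\<close>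
  satisfy the same recursion by \<open>q_binom_add_order\<close>.\<close>

lemma card_invariant_subsets:
  assumes "finite X" "semiregular_on d f X" "primitive_root_of_unity d \<omega>"
  shows "of_nat (card (invariant_subsets f X m)) = poly (q_binom (card X) m) \<omega>"
  using assms(1,2)
proof (induction "card X" arbitrary: X m rule: less_induct)
  case less
  have d: "d > 0"
    using assms(3) by (simp add: primitive_root_of_unity_def)
  show ?case
  proof (cases "X = {}")
    case True
    have "invariant_subsets f X m = (if m = 0 then {{}} else {})"
      by (auto simp: invariant_subsets_def True)
    then show ?thesis
      by (simp add: True q_binom_eq_0)
  next
    case False
    then obtain x where x: "x \<in> X" by blast
    define Or where "Or = (\<lambda>i. (f ^^ i) x) ` {..<d}"
    note orb = semiregular_on_orbit[OF less.prems(2) d x, folded Or_def]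
    define Y where "Y = X - Or"
    have [simp]: "finite Y" "finite Or"
      using less.prems by (simp_all add: Y_def Or_def)
    have card: "card X = card Y + d"
      using orb less.prems(1) card_mono[of X Or] by (simp add: Y_def card_Diff_subset)
    have Y: "semiregular_on d f Y"
      unfolding Y_def using semiregular_on_Diff less.prems d orb by blast
    have IH: "of_nat (card (invariant_subsets f Y m')) = poly (q_binom (card Y) m') \<omega>" for m'
      using less.hyps[OF _ _ Y] card d by simp
    \<comment> \<open>empty if \<open>m < d\<close>, where the truncated \<open>m - d\<close> would be wrong\<close>
    define with_orbit where
      "with_orbit = (\<lambda>S. Or \<union> S) ` {S. S \<in> invariant_subsets f Y (m - d) \<and> d \<le> m}"
    have "invariant_subsets f X m = invariant_subsets f Y m \<union> with_orbit"
    proof (intro Set.set_eqI iffI)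
      fix S assume S: "S \<in> invariant_subsets f X m"
      then have "finite S"
        using less.prems(1) by (auto simp: invariant_subsets_def intro: finite_subset)
      show "S \<in> invariant_subsets f Y m \<union> with_orbit"
      proof (cases "S \<inter> Or = {}")
        case True
        then show ?thesis using S by (auto simp: invariant_subsets_def Y_def)
      next
        case False
        then have sub: "Or \<subseteq> S"
          using orb(5) S by (auto simp: invariant_subsets_def)
        then have "f ` (S - Or) \<subseteq> S - Or"
          using semiregular_on_Diff[OF semiregular_on_subset[OF less.prems(2), of S] d \<open>finite S\<close> sub]
            S orb(3) by (auto simp: invariant_subsets_def semiregular_on_def)
        moreover have "card (S - Or) = m - d" "d \<le> m"
          using sub S \<open>finite S\<close> orb(4) card_mono[of S Or]
          by (auto simp: invariant_subsets_def card_Diff_subset)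
        ultimately have "S - Or \<in> {S. S \<in> invariant_subsets f Y (m - d) \<and> d \<le> m}"
          using S by (auto simp: invariant_subsets_def Y_def)
        moreover have "S = Or \<union> (S - Or)" using sub by blast
        ultimately show ?thesis unfolding with_orbit_def by blast
      qed
    next
      fix S assume "S \<in> invariant_subsets f Y m \<union> with_orbit"
      then show "S \<in> invariant_subsets f X m"
      proof
        assume "S \<in> with_orbit"
        then obtain T where T: "S = Or \<union> T" "T \<in> invariant_subsets f Y (m - d)" "d \<le> m"
          by (auto simp: with_orbit_def)
        then have "finite T" "Or \<inter> T = {}"
          using \<open>finite Y\<close> by (auto simp: invariant_subsets_def Y_def intro: finite_subset)
        then have "card S = m"
          using T orb(4) by (simp add: card_Un_disjoint invariant_subsets_def)
        then show ?thesis
          using T orb by (auto simp: invariant_subsets_def Y_def)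
      qed (auto simp: invariant_subsets_def Y_def)
    qed
    moreover have "invariant_subsets f Y m \<inter> with_orbit = {}"
      using orb(1) by (auto simp: invariant_subsets_def with_orbit_def Y_def)
    moreover have "card with_orbit = (if d \<le> m then card (invariant_subsets f Y (m - d)) else 0)"
    proof -
      have "inj_on (\<lambda>S. Or \<union> S) (invariant_subsets f Y (m - d))"
        by (auto simp: inj_on_def invariant_subsets_def Y_def)
      then show ?thesis
        by (simp add: with_orbit_def card_image)
    qed
    moreover have "finite with_orbit"
      by (simp add: with_orbit_def)
    ultimately have "card (invariant_subsets f X m) = card (invariant_subsets f Y m) +
        (if d \<le> m then card (invariant_subsets f Y (m - d)) else 0)"
      by (simp add: card_Un_disjoint)
    then show ?thesis
      using q_binom_add_order[OF assms(3), of "card Y" m] by (simp add: IH card)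
  qed
qed

definition invariant_disjoint_pairs :: "('a \<Rightarrow> 'a) \<Rightarrow> 'a set \<Rightarrow> nat \<Rightarrow> ('a set \<times> 'a set) set" where
  "invariant_disjoint_pairs f X k = {(A, B). A \<subseteq> X \<and> B \<subseteq> X \<and> A \<inter> B = {} \<and> card A + card B = k \<and>
     f ` A \<subseteq> A \<and> f ` B \<subseteq> B}"

text \<open>Choose \<open>A\<close> first. Since \<open>A\<close> is invariant, \<open>f\<close> is again semiregular on \<open>X - A\<close>, so that the
  number of choices for \<open>B\<close> is given by \<open>card_invariant_subsets\<close> and depends only on \<open>card A\<close>.\<close>

lemma card_invariant_disjoint_pairs:
  assumes "finite X" "semiregular_on d f X" "primitive_root_of_unity d \<omega>"
  shows "of_nat (card (invariant_disjoint_pairs f X k)) =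
    poly (\<Sum>j=0..k. q_binom (card X) j * q_binom (card X - j) (k - j)) \<omega>"
proof -
  have d: "d > 0"
    using assms(3) by (simp add: primitive_root_of_unity_def)
  let ?F = "\<lambda>j. SIGMA A : invariant_subsets f X j. invariant_subsets f (X - A) (k - j)"
  have eq: "invariant_disjoint_pairs f X k = (\<Union>j\<in>{0..k}. ?F j)"
  proof (intro Set.set_eqI iffI)
    fix p assume p: "p \<in> invariant_disjoint_pairs f X k"
    then have "card (fst p) \<in> {0..k}" "p \<in> ?F (card (fst p))"
      by (auto simp: invariant_disjoint_pairs_def invariant_subsets_def)
    then show "p \<in> (\<Union>j\<in>{0..k}. ?F j)" by blast
  qed (auto simp: invariant_disjoint_pairs_def invariant_subsets_def)
  have count: "of_nat (card (invariant_subsets f (X - A) (k - j))) =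
      poly (q_binom (card X - j) (k - j)) \<omega>" if "A \<in> invariant_subsets f X j" for A j
  proof -
    have A: "A \<subseteq> X" "f ` A \<subseteq> A" "card A = j" "finite A"
      using that assms(1) by (auto simp: invariant_subsets_def intro: finite_subset)
    then have "card (X - A) = card X - j"
      by (simp add: card_Diff_subset)
    then show ?thesis
      using card_invariant_subsets[OF _ semiregular_on_Diff[OF assms(2) d assms(1) A(1,2)] assms(3)]
        assms(1) by simp
  qed
  have "card (invariant_disjoint_pairs f X k) = (\<Sum>j\<in>{0..k}. card (?F j))"
    unfolding eq using assms(1)
    by (intro card_UN_disjoint) (auto simp: invariant_subsets_def intro!: finite_SigmaI)
  also have "\<dots> = (\<Sum>j\<in>{0..k}. \<Sum>A\<in>invariant_subsets f X j. card (invariant_subsets f (X - A) (k - j)))"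
    using assms(1) by (simp add: card_SigmaI)
  finally show ?thesis
    by (simp add: count card_invariant_subsets[OF assms] poly_sum)
qed

section \<open>Group actions\<close>

lemma group_actionI:
  assumes "group G"
    and ext: "\<And>g. g \<in> carrier G \<Longrightarrow> \<phi> g \<in> extensional E"
    and closed: "\<And>g x. g \<in> carrier G \<Longrightarrow> x \<in> E \<Longrightarrow> \<phi> g x \<in> E"
    and one: "\<And>x. x \<in> E \<Longrightarrow> \<phi> \<one>\<^bsub>G\<^esub> x = x"
    and mult: "\<And>g h x. g \<in> carrier G \<Longrightarrow> h \<in> carrier G \<Longrightarrow> x \<in> E \<Longrightarrow>
      \<phi> (g \<otimes>\<^bsub>G\<^esub> h) x = \<phi> g (\<phi> h x)"
  shows "group_action G E \<phi>"
proof -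
  interpret group G by fact
  have inverse: "\<phi> g (\<phi> (inv\<^bsub>G\<^esub> g) x) = x" "\<phi> (inv\<^bsub>G\<^esub> g) (\<phi> g x) = x"
    if "g \<in> carrier G" "x \<in> E" for g x
    using mult[of g "inv\<^bsub>G\<^esub> g" x] mult[of "inv\<^bsub>G\<^esub> g" g x] one[of x] that by simp_all
  have Bij: "\<phi> g \<in> Bij E" if "g \<in> carrier G" for g
  proof -
    have "bij_betw (\<phi> g) E E"
      by (rule bij_betw_byWitness[of _ "\<phi> (inv\<^bsub>G\<^esub> g)"]) (use inverse closed that in auto)
    then show ?thesis
      using ext that by (simp add: Bij_def)
  qed
  show ?thesis
  proof (intro group_action.intro group_hom.intro group_hom_axioms.intro homI)
    show "group G" by fact
    show "group (BijGroup E)" by (rule group_BijGroup)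
    show "\<phi> g \<in> carrier (BijGroup E)" if "g \<in> carrier G" for g
      using Bij[OF that] by (simp add: BijGroup_def)
    show "\<phi> (g \<otimes>\<^bsub>G\<^esub> h) = \<phi> g \<otimes>\<^bsub>BijGroup E\<^esub> \<phi> h"
      if "g \<in> carrier G" "h \<in> carrier G" for g h
    proof -
      have "\<phi> (g \<otimes>\<^bsub>G\<^esub> h) = compose E (\<phi> g) (\<phi> h)"
        by (rule extensionalityI[OF ext compose_extensional]) (use that mult in \<open>auto simp: compose_eq\<close>)
      then show ?thesis
        using Bij that by (simp add: BijGroup_def)
    qed
  qed
qed

text \<open>An automorphism preserves both cardinality and non-adjacency, so an action on a graph induces one
  on its independent sets.\<close>

lemma group_action_independent_sets:
  assumes "graph_action G \<Gamma> \<psi>"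
  shows "group_action G (independent_sets k \<Gamma>) (independent_sets_action k \<Gamma> \<psi>)"
proof -
  interpret group_action G "pverts \<Gamma>" \<psi>
    using assms by (simp add: graph_action_def)
  interpret group G
    using group_hom group_hom.axioms(1) by blast
  have sub: "S \<subseteq> pverts \<Gamma>" if "S \<in> independent_sets k \<Gamma>" for S
    using that by (simp add: independent_sets_def)
  have image: "\<psi> g ` S \<in> independent_sets k \<Gamma>"
    if "g \<in> carrier G" "S \<in> independent_sets k \<Gamma>" for g S
  proof -
    have "inj_on (\<psi> g) S"
      using inj_prop[OF that(1)] sub[OF that(2)] by (rule inj_on_subset)
    moreover have "\<psi> g ` S \<subseteq> pverts \<Gamma>"
      using surj_prop[OF that(1)] sub[OF that(2)] by blast
    moreover have "(\<psi> g u, \<psi> g v) \<notin> parcs \<Gamma>" if "u \<in> S" "v \<in> S" for u v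
      using assms that \<open>g \<in> carrier G\<close> \<open>S \<in> _\<close> sub[OF \<open>S \<in> _\<close>]
      unfolding graph_action_def independent_sets_def by blast
    ultimately show ?thesis
      using that by (auto simp: independent_sets_def card_image)
  qed
  show ?thesis
  proof (rule group_actionI)
    show "group G" by (rule is_group)
    show "independent_sets_action k \<Gamma> \<psi> g \<in> extensional (independent_sets k \<Gamma>)" for g
      by (simp add: independent_sets_action_def)
    show "independent_sets_action k \<Gamma> \<psi> g S \<in> independent_sets k \<Gamma>"
      if "g \<in> carrier G" "S \<in> independent_sets k \<Gamma>" for g S
      using image that by (simp add: independent_sets_action_def)
    show "independent_sets_action k \<Gamma> \<psi> \<one>\<^bsub>G\<^esub> S = S"
      if S: "S \<in> independent_sets k \<Gamma>" for S
    proof -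
      have "\<psi> \<one>\<^bsub>G\<^esub> ` S = S"
        using sub[OF S] by (force simp: id_eq_one[symmetric])
      then show ?thesis
        using S by (simp add: independent_sets_action_def)
    qed
    show "independent_sets_action k \<Gamma> \<psi> (g \<otimes>\<^bsub>G\<^esub> h) S =
        independent_sets_action k \<Gamma> \<psi> g (independent_sets_action k \<Gamma> \<psi> h S)"
      if g: "g \<in> carrier G" and h: "h \<in> carrier G" and S: "S \<in> independent_sets k \<Gamma>" for g h S
    proof -
      have "\<psi> (g \<otimes>\<^bsub>G\<^esub> h) x = \<psi> g (\<psi> h x)" if "x \<in> S" for x
        using composition_rule g h sub[OF S] that by blast
      then have "\<psi> (g \<otimes>\<^bsub>G\<^esub> h) ` S = \<psi> g ` \<psi> h ` S"
        by (force simp: image_iff)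
      then show ?thesis
        using S image h by (simp add: independent_sets_action_def)
    qed
  qed
qed

text \<open>The iterates of \<open>\<phi> g\<close> are the \<open>\<phi> (g\<^sup>i)\<close>, and \<open>g\<^sup>i\<close> is not the identity for
  \<open>0 < i < ord g\<close>, so by freeness it fixes no point.\<close>

lemma free_action_semiregular_on:
  assumes "free_action G X \<phi>" "g \<in> carrier G"
  shows "semiregular_on (group.ord G g) (\<phi> g) X"
proof -
  interpret group_action G X \<phi>
    using assms by (simp add: free_action_def)
  interpret group G
    using group_hom group_hom.axioms(1) by blast
  have pow: "(\<phi> g ^^ i) x = \<phi> (g [^]\<^bsub>G\<^esub> i) x" if "x \<in> X" for i :: nat and x
  proof (induction i)
    case 0
    then show ?case
      using that by (simp add: id_eq_one[symmetric])
  next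
    case (Suc i)
    have "\<phi> (g [^]\<^bsub>G\<^esub> Suc i) x = \<phi> (g \<otimes>\<^bsub>G\<^esub> g [^]\<^bsub>G\<^esub> i) x"
      using assms(2) by (simp only: nat_pow_Suc2)
    then show ?case
      using Suc that composition_rule[of x g "g [^]\<^bsub>G\<^esub> i"] assms(2) by simp
  qed
  show ?thesis
    unfolding semiregular_on_def
  proof (intro conjI ballI allI impI)
    show "\<phi> g ` X \<subseteq> X"
      using surj_prop[OF assms(2)] by simp
    fix x assume x: "x \<in> X"
    show "(\<phi> g ^^ ord g) x = x"
      using x assms(2) by (simp add: pow id_eq_one[symmetric])
    fix i assume i: "0 < i \<and> i < ord g"
    then have "g [^]\<^bsub>G\<^esub> i \<noteq> \<one>\<^bsub>G\<^esub>"
      using assms(2) by (auto simp: pow_eq_id dest: dvd_imp_le)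
    then show "(\<phi> g ^^ i) x \<noteq> x"
      using assms x by (auto simp: pow free_action_def)
  qed
qed

section \<open>Independent sets of the book graph\<close>

lemma pverts_book_graph: "pverts (book_graph n) = {0..n} \<times> {1, -1}"
  by (simp add: book_graph_def)

lemma parcs_book_graph:
  assumes "(i, s) \<in> pverts (book_graph n)" "(j, t) \<in> pverts (book_graph n)"
  shows "((i, s), (j, t)) \<in> parcs (book_graph n) \<longleftrightarrow>
    (if i = j then s \<noteq> t else (i = n \<or> j = n) \<and> s = t)"
proof -
  have ij: "i \<le> n" "j \<le> n"
    using assms by (simp_all add: pverts_book_graph)
  have "s = 1 \<or> s = -1" "t = 1 \<or> t = -1"
    using assms by (simp_all add: pverts_book_graph)
  then show ?thesis
    using ij by (elim disjE) (simp_all add: book_graph_def book_edges_def le_less, auto)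
qed

lemma graph_action_book_action:
  assumes "group_action G {0..<n} \<phi>"
  shows "graph_action G (book_graph n) (book_action n \<phi>)"
proof -
  interpret group_action G "{0..<n}" \<phi> by fact
  interpret group G
    using group_hom group_hom.axioms(1) by blast
  have less: "\<phi> g i < n" if "g \<in> carrier G" "i < n" for g i
    using element_image[of g i "\<phi> g i"] that by simp
  have inj: "\<phi> g i = \<phi> g j \<longleftrightarrow> i = j" if "g \<in> carrier G" "i < n" "j < n" for g i j
    using inj_prop[of g] that by (auto simp: inj_on_def)
  have one: "\<phi> \<one>\<^bsub>G\<^esub> i = i" if "i < n" for i
    using that by (simp add: id_eq_one[symmetric])
  have mult: "\<phi> (g \<otimes>\<^bsub>G\<^esub> h) i = \<phi> g (\<phi> h i)" if "g \<in> carrier G" "h \<in> carrier G" "i < n" for g h i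
    using that by (simp add: composition_rule)
  let ?V = "pverts (book_graph n)"
  have act: "book_action n \<phi> g (i, s) = (if i = n then i else \<phi> g i, s)"
    if "(i, s) \<in> ?V" for g i s
    using that by (simp add: book_action_def)
  have closed: "book_action n \<phi> g v \<in> ?V" if "g \<in> carrier G" "v \<in> ?V" for g v
    using that less[of g "fst v"] by (cases v) (auto simp: act pverts_book_graph le_less)
  have "group_action G ?V (book_action n \<phi>)"
  proof (rule group_actionI)
    show "group G" by (rule is_group)
    show "book_action n \<phi> g \<in> extensional ?V" for g
      by (simp add: book_action_def)
    show "book_action n \<phi> g v \<in> ?V" if "g \<in> carrier G" "v \<in> ?V" for g v
      by (rule closed[OF that])
    show "book_action n \<phi> \<one>\<^bsub>G\<^esub> v = v" if "v \<in> ?V" for v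
      using that by (cases v) (auto simp: act one pverts_book_graph)
    show "book_action n \<phi> (g \<otimes>\<^bsub>G\<^esub> h) v = book_action n \<phi> g (book_action n \<phi> h v)"
      if "g \<in> carrier G" "h \<in> carrier G" "v \<in> ?V" for g h v
      using that closed[of h v] less[of h "fst v"] mult[of g h "fst v"]
      by (cases v) (auto simp: act pverts_book_graph)
  qed
  moreover have "(book_action n \<phi> g u, book_action n \<phi> g v) \<in> parcs (book_graph n) \<longleftrightarrow>
      (u, v) \<in> parcs (book_graph n)"
    if "g \<in> carrier G" "u \<in> ?V" "v \<in> ?V" for g u v
  proof -
    obtain i s j t where uv: "u = (i, s)" "v = (j, t)" by (cases u, cases v)
    let ?F = "\<lambda>i. if i = n then i else \<phi> g i"
    have le: "i \<le> n" "j \<le> n"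
      using that by (simp_all add: uv pverts_book_graph)
    then have F: "?F i = ?F j \<longleftrightarrow> i = j" "?F i = n \<longleftrightarrow> i = n" "?F j = n \<longleftrightarrow> j = n"
      using less[OF that(1), of i] less[OF that(1), of j] inj[OF that(1), of i j] by auto
    have "(?F i, s) \<in> ?V" "(?F j, t) \<in> ?V"
      using closed[OF that(1,2)] closed[OF that(1,3)] act that by (simp_all only: uv)
    then have "((?F i, s), (?F j, t)) \<in> parcs (book_graph n) \<longleftrightarrow>
        ((i, s), (j, t)) \<in> parcs (book_graph n)"
      using that by (simp only: uv parcs_book_graph F)
    then show ?thesis
      using act that by (simp only: uv)
  qed
  ultimately show ?thesis
    by (simp add: graph_action_def)
qed

text \<open>The vertices \<open>(i, 1)\<close> with \<open>i \<in> A\<close> and \<open>(i, -1)\<close> with \<open>i \<in> B\<close>. For \<open>A\<close> and \<open>B\<close> below \<open>n\<close>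
  these lie off the spine \<open>(n, 1)\<close>, \<open>(n, -1)\<close> of the book.\<close>

definition page_set :: "'a set \<Rightarrow> 'a set \<Rightarrow> ('a \<times> int) set" where
  "page_set A B = A \<times> {1} \<union> B \<times> {-1}"

lemma page_set_iff [simp]:
  "(i, s) \<in> page_set A B \<longleftrightarrow> (i \<in> A \<and> s = 1) \<or> (i \<in> B \<and> s = -1)"
  by (auto simp: page_set_def)

lemma finite_page_set [simp]: "finite A \<Longrightarrow> finite B \<Longrightarrow> finite (page_set A B)"
  by (simp add: page_set_def)

lemma card_page_set:
  "finite A \<Longrightarrow> finite B \<Longrightarrow> card (page_set A B) = card A + card B"
  unfolding page_set_def by (subst card_Un_disjoint) auto

lemma page_set_eq_iff [simp]: "page_set A B = page_set A' B' \<longleftrightarrow> A = A' \<and> B = B'"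
proof -
  have "A = {i. (i, 1) \<in> page_set A B}" "B = {i. (i, -1) \<in> page_set A B}" for A B :: "'a set"
    by auto
  then show ?thesis by metis
qed

text \<open>An independent set contains at most one of the two adjacent spine vertices. If it contains
  \<open>(n, 1)\<close>, it has no further vertex \<open>(i, 1)\<close>, and its vertices \<open>(i, -1)\<close> can be chosen freely;
  symmetrically for \<open>(n, -1)\<close>. If it avoids the spine, independence only forbids \<open>(i, 1)\<close> and
  \<open>(i, -1)\<close> together, so it is given by two disjoint sets of indices. Since \<open>\<psi>\<close> fixes the spine and
  acts by \<open>f\<close> on the indices, invariance can be tested on these index sets.\<close>

lemma fixed_independent_sets_book_graph:
  assumes f: "f ` {0..<n} \<subseteq> {0..<n}" and "k > 0"
    and \<psi>: "\<And>i s. (i, s) \<in> pverts (book_graph n) \<Longrightarrow> \<psi> (i, s) = (if i = n then i else f i, s)"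
  shows "{S \<in> independent_sets k (book_graph n). \<psi> ` S \<subseteq> S} =
    (\<lambda>B. insert (n, 1) (page_set {} B)) ` invariant_subsets f {0..<n} (k - 1) \<union>
    (\<lambda>A. insert (n, -1) (page_set A {})) ` invariant_subsets f {0..<n} (k - 1) \<union>
    (\<lambda>(A, B). page_set A B) ` invariant_disjoint_pairs f {0..<n} k" (is "?L = ?P \<union> ?M \<union> ?D")
proof (intro Set.equalityI subsetI)
  fix S assume "S \<in> ?L"
  then have sub: "S \<subseteq> pverts (book_graph n)" and card: "card S = k"
    and indep: "\<And>u v. u \<in> S \<Longrightarrow> v \<in> S \<Longrightarrow> (u, v) \<notin> parcs (book_graph n)"
    and inv: "\<psi> ` S \<subseteq> S"
    by (auto simp: independent_sets_def)
  have verts: "i \<le> n \<and> (s = 1 \<or> s = -1)" if "(i, s) \<in> S" for i s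
    using sub that by (auto simp: pverts_book_graph)
  have nonadj: "\<not> (if i = j then s \<noteq> t else (i = n \<or> j = n) \<and> s = t)"
    if "(i, s) \<in> S" "(j, t) \<in> S" for i j s t
    using indep[OF that] sub that parcs_book_graph by blast
  define layer where "layer s = {i \<in> {0..<n}. (i, s) \<in> S}" for s :: int
  have fin: "finite (layer s)" "layer s \<subseteq> {0..<n}" for s
    by (auto simp: layer_def)
  have closed: "f ` layer s \<subseteq> layer s" for s
  proof
    fix j assume "j \<in> f ` layer s"
    then obtain i where i: "j = f i" "i < n" "(i, s) \<in> S"
      by (auto simp: layer_def)
    then have "\<psi> (i, s) = (j, s)"
      using \<psi>[of i s] sub by auto
    then have "(j, s) \<in> S"
      using inv i(3) by (metis image_subset_iff)
    then show "j \<in> layer s"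
      using f i(1,2) by (auto simp: layer_def image_subset_iff)
  qed
  consider "(n, 1) \<in> S" | "(n, -1) \<in> S" | "(n, 1) \<notin> S" "(n, -1) \<notin> S" by blast
  then show "S \<in> ?P \<union> ?M \<union> ?D"
  proof cases
    case 1
    have S: "S = insert (n, 1) (page_set {} (layer (-1)))"
      using nonadj[OF 1] 1 verts by (fastforce simp: layer_def le_less)
    have "card S = Suc (card (layer (-1)))"
      using fin by (subst S, subst card_insert_disjoint) (auto simp: card_page_set)
    then have "layer (-1) \<in> invariant_subsets f {0..<n} (k - 1)"
      using fin closed card by (simp add: invariant_subsets_def)
    then show ?thesis using S by blast
  next
    case 2
    have S: "S = insert (n, -1) (page_set (layer 1) {})"
      using nonadj[OF 2] 2 verts by (fastforce simp: layer_def le_less)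
    have "card S = Suc (card (layer 1))"
      using fin by (subst S, subst card_insert_disjoint) (auto simp: card_page_set)
    then have "layer 1 \<in> invariant_subsets f {0..<n} (k - 1)"
      using fin closed card by (simp add: invariant_subsets_def)
    then show ?thesis using S by blast
  next
    case 3
    have S: "S = page_set (layer 1) (layer (-1))"
      using 3 verts by (fastforce simp: layer_def le_less)
    have "card S = card (layer 1) + card (layer (-1))"
      using fin by (subst S) (simp add: card_page_set)
    moreover have "layer 1 \<inter> layer (-1) = {}"
      using nonadj by (fastforce simp: layer_def)
    ultimately have "(layer 1, layer (-1)) \<in> invariant_disjoint_pairs f {0..<n} k"
      using fin closed card by (simp add: invariant_disjoint_pairs_def)
    then show ?thesis using S by (metis (no_types, lifting) UnI2 case_prod_conv image_eqI)
  qed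
next
  have fin: "finite A" if "A \<subseteq> {0..<n}" for A
    using that finite_subset by blast
  have independentI: "S \<in> ?L"
    if sub: "S \<subseteq> pverts (book_graph n)" and card: "finite S" "card S = k"
      and nonadj: "\<And>i s j t. (i, s) \<in> S \<Longrightarrow> (j, t) \<in> S \<Longrightarrow>
        \<not> (if i = j then s \<noteq> t else (i = n \<or> j = n) \<and> s = t)"
      and closed: "\<And>i s. (i, s) \<in> S \<Longrightarrow> (if i = n then i else f i, s) \<in> S" for S
  proof -
    have "((i, s), (j, t)) \<notin> parcs (book_graph n)" if "(i, s) \<in> S" "(j, t) \<in> S" for i s j t
      using nonadj[OF that] sub that parcs_book_graph by blast
    moreover have "\<psi> ` S \<subseteq> S"
    proof (rule image_subsetI)
      fix v assume "v \<in> S"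
      then show "\<psi> v \<in> S"
        using closed[of "fst v" "snd v"] sub \<psi>[of "fst v" "snd v"] by auto
    qed
    ultimately show ?thesis
      using sub card by (auto simp: independent_sets_def)
  qed
  fix S assume "S \<in> ?P \<union> ?M \<union> ?D"
  then consider B where "S = insert (n, 1) (page_set {} B)" "B \<in> invariant_subsets f {0..<n} (k - 1)"
    | A where "S = insert (n, -1) (page_set A {})" "A \<in> invariant_subsets f {0..<n} (k - 1)"
    | A B where "S = page_set A B" "(A, B) \<in> invariant_disjoint_pairs f {0..<n} k"
    by auto
  then show "S \<in> ?L"
  proof cases
    case 1
    then have B: "B \<subseteq> {0..<n}" "card B = k - 1" "f ` B \<subseteq> B" "finite B"
      by (auto simp: invariant_subsets_def fin)
    then have "(n, 1) \<notin> page_set {} B" by auto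
    then have "card S = k"
      using B \<open>k > 0\<close> by (simp add: 1 card_page_set)
    then show ?thesis
      using B by (intro independentI) (auto simp: 1 pverts_book_graph)
  next
    case 2
    then have A: "A \<subseteq> {0..<n}" "card A = k - 1" "f ` A \<subseteq> A" "finite A"
      by (auto simp: invariant_subsets_def fin)
    then have "(n, -1) \<notin> page_set A {}" by auto
    then have "card S = k"
      using A \<open>k > 0\<close> by (simp add: 2 card_page_set)
    then show ?thesis
      using A by (intro independentI) (auto simp: 2 pverts_book_graph)
  next
    case 3
    then have AB: "A \<subseteq> {0..<n}" "B \<subseteq> {0..<n}" "A \<inter> B = {}" "card A + card B = k"
        "f ` A \<subseteq> A" "f ` B \<subseteq> B" "finite A" "finite B"
      by (auto simp: invariant_disjoint_pairs_def fin)
    then have "card S = k" "n \<notin> A" "n \<notin> B"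
      by (auto simp: 3 card_page_set)
    moreover have "\<forall>i\<in>A. i \<le> n" "\<forall>i\<in>B. i \<le> n"
      using AB(1,2) by force+
    ultimately show ?thesis
      using AB by (intro independentI) (auto simp: 3 pverts_book_graph)
  qed
qed

lemma card_fixed_independent_sets_book_graph:
  assumes "f ` {0..<n} \<subseteq> {0..<n}" "k > 0"
    and "\<And>i s. (i, s) \<in> pverts (book_graph n) \<Longrightarrow> \<psi> (i, s) = (if i = n then i else f i, s)"
  shows "card {S \<in> independent_sets k (book_graph n). \<psi> ` S \<subseteq> S} =
    2 * card (invariant_subsets f {0..<n} (k - 1)) + card (invariant_disjoint_pairs f {0..<n} k)"
proof -
  let ?I = "invariant_subsets f {0..<n} (k - 1)" and ?J = "invariant_disjoint_pairs f {0..<n} k"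
  let ?P = "(\<lambda>B. insert (n, 1) (page_set {} B)) ` ?I"
    and ?M = "(\<lambda>A. insert (n, -1) (page_set A {})) ` ?I"
    and ?D = "(\<lambda>(A, B). page_set A B) ` ?J"
  have spine: "(n, s) \<notin> page_set A B" if "A \<subseteq> {0..<n}" "B \<subseteq> {0..<n}" for s A B
    using that by auto
  have "?J \<subseteq> Pow {0..<n} \<times> Pow {0..<n}"
    by (auto simp: invariant_disjoint_pairs_def)
  then have fin: "finite ?J"
    by (rule finite_subset) simp
  have "card ?P = card ?I"
    by (rule card_image) (auto simp: inj_on_def invariant_subsets_def spine dest!: insert_ident[THEN iffD1, rotated 2])
  moreover have "card ?M = card ?I"
    by (rule card_image) (auto simp: inj_on_def invariant_subsets_def spine dest!: insert_ident[THEN iffD1, rotated 2])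
  moreover have "card ?D = card ?J"
    by (rule card_image) (auto simp: inj_on_def)
  moreover have "?P \<inter> ?M = {}"
  proof -
    have "(n, 1) \<in> S" if "S \<in> ?P" for S
      using that by auto
    moreover have "(n, 1) \<notin> S" if "S \<in> ?M" for S
      using that by (auto simp: invariant_subsets_def)
    ultimately show ?thesis by blast
  qed
  moreover have "(?P \<union> ?M) \<inter> ?D = {}"
  proof -
    have "(n, 1) \<in> S \<or> (n, -1) \<in> S" if "S \<in> ?P \<union> ?M" for S
      using that by auto
    moreover have "(n, 1) \<notin> S \<and> (n, -1) \<notin> S" if "S \<in> ?D" for S
      using that by (auto simp: invariant_disjoint_pairs_def)
    ultimately show ?thesis by (metis disjoint_iff)
  qed
  ultimately show ?thesis
    using fin by (simp add: fixed_independent_sets_book_graph[OF assms] card_Un_disjoint)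
qed

section \<open>Cyclic sieving\<close>

theorem proposition16:
  fixes n k :: nat
    and C :: "('g, 'm) monoid_scheme"
    and \<phi> :: "'g \<Rightarrow> nat \<Rightarrow> nat"
  assumes "n > 0" and "k > 0"
    and "group C" and "cyclic_group C" and "finite (carrier C)"
    and "free_action C {0..<n} \<phi>"
  shows "graph_action C (book_graph n) (book_action n \<phi>) \<and>
    cyclic_sieving
      (independent_sets k (book_graph n)) C
      (independent_sets_action k (book_graph n) (book_action n \<phi>))
      (2 * q_binom n (k - 1) + (\<Sum>j=0..k. q_binom n j * q_binom (n - j) (k - j)))"
proof
  have act: "group_action C {0..<n} \<phi>"
    using assms by (simp add: free_action_def)
  show graph: "graph_action C (book_graph n) (book_action n \<phi>)"
    by (rule graph_action_book_action[OF act])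
  then interpret V: group_action C "pverts (book_graph n)" "book_action n \<phi>"
    by (simp add: graph_action_def)
  let ?X = "independent_sets k (book_graph n)"
    and ?\<Psi> = "independent_sets_action k (book_graph n) (book_action n \<phi>)"
  have "finite ?X"
    by (rule finite_subset[of _ "Pow (pverts (book_graph n))"])
      (auto simp: independent_sets_def pverts_book_graph)
  moreover have "of_nat (card (invariants ?X ?\<Psi> g)) =
      poly (2 * q_binom n (k - 1) + (\<Sum>j=0..k. q_binom n j * q_binom (n - j) (k - j))) \<omega>"
    if g: "g \<in> carrier C" and \<omega>: "primitive_root_of_unity (group.ord C g) \<omega>" for g \<omega>
  proof -
    have semi: "semiregular_on (group.ord C g) (\<phi> g) {0..<n}"
      by (rule free_action_semiregular_on[OF assms(6) g])
    then have maps: "\<phi> g ` {0..<n} \<subseteq> {0..<n}"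
      by (simp add: semiregular_on_def)
    \<comment> \<open>being fixed by \<open>g\<close> means equality with the image, whereas invariance was counted as inclusion\<close>
    have "book_action n \<phi> g ` S = S \<longleftrightarrow> book_action n \<phi> g ` S \<subseteq> S" if "S \<in> ?X" for S
    proof -
      have "finite S" "inj_on (book_action n \<phi> g) S"
        using that V.inj_prop[OF g] by (auto simp: independent_sets_def intro: inj_on_subset)
      then show ?thesis
        using endo_inj_surj by blast
    qed
    then have "invariants ?X ?\<Psi> g = {S \<in> ?X. book_action n \<phi> g ` S \<subseteq> S}"
      by (auto simp: invariants_def independent_sets_action_def)
    then have "card (invariants ?X ?\<Psi> g) = 2 * card (invariant_subsets (\<phi> g) {0..<n} (k - 1)) +
        card (invariant_disjoint_pairs (\<phi> g) {0..<n} k)"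
      using card_fixed_independent_sets_book_graph[OF maps \<open>k > 0\<close>, of "book_action n \<phi> g"]
      by (simp add: book_action_def)
    then show ?thesis
      using card_invariant_subsets[OF _ semi \<omega>] card_invariant_disjoint_pairs[OF _ semi \<omega>] by simp
  qed
  ultimately show "cyclic_sieving ?X C ?\<Psi>
      (2 * q_binom n (k - 1) + (\<Sum>j=0..k. q_binom n j * q_binom (n - j) (k - j)))"
    using assms group_action_independent_sets[OF graph] by (simp add: cyclic_sieving_def)
qed

end
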